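(* Let $L\subseteq\{0,1\}^*$ be a 0-1-symmetric language. The following four conditions are equivalent: (1) there is some $t\geq 0$ such that all graphs in $\mathcal{G}_L$ have treewidth at most $t$; (2) all graphs in $\mathcal{G}_L$ have treewidth $0$; (3) $\mathcal{G}_L=\{N_n\mid n\in\mathbb{N}, n\geq 1\}$, where $N_n$ is the edgeless graph on $n$ vertices; (4) $L\subseteq 0^*\cup 1^*$.
   Context: All graphs are finite, simple, undirected, with nonempty vertex sets, and graph classes are considered up to isomorphism. For $w\in\{0,1\}^*$ let $\widetilde{w}$ be obtained from $w$ by exchanging the letters 0 and 1; a language $L\subseteq\{0,1\}^*$ is 0-1-symmetric if $L=\{\widetilde w : w\in L\}$. For an alphabet $V$ and distinct $u,v\in V$, $h_{u,v}:V^*\to\{0,1\}^*$ is the monoid morphism with $u\mapsto 0$, $v\mapsto 1$ and $x\mapsto\lambda$ (empty word) for all other letters $x$. For a 0-1-symmetric $L$ and a nonempty word $w$ whose set of occurring letters is $V$, $G(L,w)$ is the graph with vertex set $V$ in which distinct $u,v$ are adjacent iff $h_{u,v}(w)\in L$. A graph is $L$-representable if it is isomorphic to some $G(L,w)$, and $\mathcal{G}_L$ denotes the class of all $L$-representable graphs. *)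

theory Defs
  imports "HOL-Library.Z2" "Graph_Theory.Digraph_Isomorphism"
begin

section \<open>Graphs\<close>

text \<open>
  An undirected graph is represented by its symmetric, irreflexive arc relation:
  the locale \<^term>\<open>pair_graph\<close> describes exactly the finite simple undirected graphs.
\<close>

definition simple_graph :: "'a pair_pre_digraph \<Rightarrow> bool" where
  "simple_graph G \<longleftrightarrow> pair_graph G \<and> pverts G \<noteq> {}"

definition graph_iso :: "'a pair_pre_digraph \<Rightarrow> 'b pair_pre_digraph \<Rightarrow> bool" where
  "graph_iso G H \<longleftrightarrow> digraph_iso (with_proj G) (with_proj H)"

definition edgeless :: "nat \<Rightarrow> nat pair_pre_digraph" where
  "edgeless n = \<lparr>pverts = {1..n}, parcs = {}\<rparr>"

text \<open>
  Graph classes are considered up to isomorphism. They are rendered as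
  isomorphism-closed sets of graphs on natural numbers, since every finite graph has an
  isomorphic copy of this kind.
\<close>

definition iso_closure :: "'a pair_pre_digraph set \<Rightarrow> nat pair_pre_digraph set" where
  "iso_closure S = {G. simple_graph G \<and> (\<exists>H\<in>S. graph_iso G H)}"


section \<open>Treewidth\<close>

text \<open>
  The library predicate \<^term>\<open>tree\<close> does not fit: its cycles include the walk along an edge and
  back (so a symmetric digraph with an arc is never a forest). Cycles of a simple
  undirected graph have length at least 3.
\<close>

definition undirected_tree :: "'a pair_pre_digraph \<Rightarrow> bool" where
  "undirected_tree T \<longleftrightarrow>
     pair_graph T \<and> connected (with_proj T) \<and>
     \<not> (\<exists>p. pre_digraph.cycle (with_proj T) p \<and> length p \<ge> 3)"

definition tree_decomposition ::
  "'a pair_pre_digraph \<Rightarrow> 'b pair_pre_digraph \<Rightarrow> ('b \<Rightarrow> 'a set) \<Rightarrow> bool" where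
  "tree_decomposition G T B \<longleftrightarrow>
     undirected_tree T \<and>
     (\<Union>t\<in>pverts T. B t) = pverts G \<and>
     (\<forall>(u, v)\<in>parcs G. \<exists>t\<in>pverts T. u \<in> B t \<and> v \<in> B t) \<and>
     (\<forall>v\<in>pverts G. connected (with_proj T \<restriction> {t \<in> pverts T. v \<in> B t}))"

text \<open>
  The truncated subtraction is harmless: a decomposition of a graph with at least one vertex has
  a nonempty bag.
\<close>

definition decomposition_width :: "'b pair_pre_digraph \<Rightarrow> ('b \<Rightarrow> 'a set) \<Rightarrow> nat" where
  "decomposition_width T B = Max ((\<lambda>t. card (B t)) ` pverts T) - 1"

definition treewidth :: "'a pair_pre_digraph \<Rightarrow> nat" where
  "treewidth G =
     (LEAST k. \<exists>(T :: nat pair_pre_digraph) B.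
        tree_decomposition G T B \<and> decomposition_width T B = k)"


section \<open>Graphs represented by words\<close>

definition exchange01 :: "bit list \<Rightarrow> bit list" where
  "exchange01 w = map (\<lambda>b. if b = 0 then 1 else 0) w"

definition symmetric01 :: "bit list set \<Rightarrow> bool" where
  "symmetric01 L \<longleftrightarrow> L = {exchange01 w | w. w \<in> L}"

definition pair_morphism :: "'a \<Rightarrow> 'a \<Rightarrow> 'a list \<Rightarrow> bit list" where
  "pair_morphism u v w =
     concat (map (\<lambda>x. if x = u then [0] else if x = v then [1] else []) w)"

text \<open>For a 0-1-symmetric language the arc relation below is symmetric.\<close>

definition word_graph :: "bit list set \<Rightarrow> 'a list \<Rightarrow> 'a pair_pre_digraph" where
  "word_graph L w =
     \<lparr>pverts = set w,
      parcs = {(u, v). u \<in> set w \<and> v \<in> set w \<and> u \<noteq> v \<and> pair_morphism u v w \<in> L}\<rparr>"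

text \<open>
  Renaming letters yields isomorphic graphs, so words over the natural numbers cover all
  finite alphabets.
\<close>

definition representable :: "bit list set \<Rightarrow> 'a pair_pre_digraph \<Rightarrow> bool" where
  "representable L G \<longleftrightarrow>
     simple_graph G \<and> (\<exists>w :: nat list. w \<noteq> [] \<and> graph_iso G (word_graph L w))"

definition graph_class :: "bit list set \<Rightarrow> nat pair_pre_digraph set" where
  "graph_class L = {G. representable L G}"

end

theory Submission
  imports Defs
begin

text \<open>
  If \<open>L\<close> contains a word \<open>x\<close> with both letters, replace in \<open>x\<close> every 0 by a block \<open>u\<^sub>1 \<dots> u\<^sub>n\<close>
  and every 1 by a block \<open>v\<^sub>1 \<dots> v\<^sub>n\<close> of fresh letters. Projecting the result to \<open>u\<^sub>i, v\<^sub>j\<close>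
  returns \<open>x\<close>, so its graph contains the complete bipartite graph on \<open>n + n\<close> vertices and has
  minimum degree at least \<open>n\<close>. The treewidth is at least the minimum degree: deleting redundant
  leaves from a tree decomposition exposes a bag that contains a vertex with all its neighbours.
  Conversely, if no word of \<open>L\<close> has both letters, then no two letters of a word can be adjacent.
\<close>

section \<open>Leaves\<close>

text \<open>Acyclicity (of a symmetric irreflexive relation on a finite set) in a form that passes
  to subsets of \<open>V\<close> at once, so an induction that deletes leaves needs neither cycles
  nor connectedness.\<close>

definition leafy :: "'b set \<Rightarrow> ('b \<times> 'b) set \<Rightarrow> bool" where
  "leafy V E \<longleftrightarrow>
     (\<forall>S\<subseteq>V. S \<noteq> {} \<longrightarrow> (\<exists>x\<in>S. \<forall>y\<in>S. \<forall>z\<in>S. (x, y) \<in> E \<longrightarrow> (x, z) \<in> E \<longrightarrow> y = z))"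

text \<open>Translates a path given as a list of nodes into a library walk, which is a list of arcs:
  zipping the nodes with their tail yields the arcs.\<close>

lemma walk_of_successively:
  assumes "successively (\<lambda>a b. (a, b) \<in> E) (x # zs)"
  shows "set (zip (x # zs) zs) \<subseteq> E"
    and "pcas x (zip (x # zs) zs) (last (x # zs))"
    and "pawalk_verts x (zip (x # zs) zs) = x # zs"
  using assms by (induction zs arbitrary: x) auto

lemma cycle_of_successively:
  assumes "successively (\<lambda>a b. (a, b) \<in> parcs T) (x # zs)" "last zs = x" "zs \<noteq> []"
    and "distinct zs" "x \<in> pverts T"
  shows "pre_digraph.cycle (with_proj T) (zip (x # zs) zs)"
  using walk_of_successively[OF assms(1)] assms(2-)
  by (auto simp: pre_digraph.cycle_def pre_digraph.awalk_def cas_with_proj_eq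
      awalk_verts_with_proj_eq intro!: exI[of _ x])

text \<open>In a set where every node has two neighbours, the end of a longest path has a neighbour on
  the path other than its predecessor, which closes a cycle.\<close>

lemma undirected_tree_leafy:
  assumes "undirected_tree T"
  shows "leafy (pverts T) (parcs T)"
  unfolding leafy_def
proof (intro allI impI, rule ccontr)
  fix S assume S: "S \<subseteq> pverts T" "S \<noteq> {}"
    and "\<not> (\<exists>x\<in>S. \<forall>y\<in>S. \<forall>z\<in>S. (x, y) \<in> parcs T \<longrightarrow> (x, z) \<in> parcs T \<longrightarrow> y = z)"
  then have two: "\<exists>y\<in>S. \<exists>z\<in>S. (x, y) \<in> parcs T \<and> (x, z) \<in> parcs T \<and> y \<noteq> z" if "x \<in> S" for x
    using that by blast
  have "pair_graph T" using assms by (simp add: undirected_tree_def)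
  then interpret T: pair_graph T .
  have finS: "finite S" using S(1) T.pair_finite_verts finite_subset by blast
  define P where "P xs \<longleftrightarrow>
    xs \<noteq> [] \<and> distinct xs \<and> set xs \<subseteq> S \<and> successively (\<lambda>a b. (a, b) \<in> parcs T) xs" for xs
  obtain s where "s \<in> S" using S(2) by blast
  then have "P [s]" by (simp add: P_def)
  moreover have "\<forall>xs. P xs \<longrightarrow> length xs < Suc (card S)"
    unfolding P_def by (metis card_mono distinct_card finS less_Suc_eq_le)
  ultimately obtain p where p: "P p" and longest: "\<And>xs. P xs \<Longrightarrow> length xs \<le> length p"
    using ex_has_greatest_nat[of P "[s]" length "Suc (card S)"] by (metis less_imp_le)
  \<comment> \<open>Paths are extended at the front, so the end in question is the head
    \<open>x\<close>, and its predecessor is \<open>hd ys\<close>.\<close>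
  obtain x ys where xys: "p = x # ys" using p by (cases p) (auto simp: P_def)
  have xS: "x \<in> S" using p xys by (auto simp: P_def)
  have onp: "y \<in> set ys" if "y \<in> S" "(x, y) \<in> parcs T" for y
  proof (rule ccontr)
    assume "y \<notin> set ys"
    moreover have "y \<noteq> x" using that(2) T.no_loops' by blast
    moreover have "(y, x) \<in> parcs T" using that(2) by (rule T.arcs_symmetric)
    ultimately have "P (y # p)" using p that(1) by (auto simp: P_def xys)
    then show False using longest by fastforce
  qed
  \<comment> \<open>Of two distinct neighbours one differs from \<open>hd ys\<close>, even when
    \<open>ys\<close> is empty and \<open>hd ys\<close> arbitrary. As \<open>z\<close> is not the
    head of \<open>ys\<close>, \<open>as\<close> is nonempty and the cycle has at least three
    arcs.\<close>
  obtain z where z: "z \<in> S" "(x, z) \<in> parcs T" "z \<noteq> hd ys" using two[OF xS] by metis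
  obtain as bs where ys: "ys = as @ z # bs" using onp[OF z(1,2)] by (meson split_list)
  have "as \<noteq> []" using z(3) ys by auto
  define zs where "zs = as @ [z, x]"
  have "successively (\<lambda>a b. (a, b) \<in> parcs T) (x # as @ [z])"
    using p unfolding P_def xys ys
    by (metis append_Cons append_Nil append_assoc successively_append_iff)
  then have "successively (\<lambda>a b. (a, b) \<in> parcs T) ((x # as @ [z]) @ [x])"
    using T.arcs_symmetric[OF z(2)] by (subst successively_append_iff) simp
  then have "successively (\<lambda>a b. (a, b) \<in> parcs T) (x # zs)" by (simp add: zs_def)
  moreover have "distinct zs" using p by (auto simp: P_def xys ys zs_def)
  ultimately have "pre_digraph.cycle (with_proj T) (zip (x # zs) zs)"
    using xS S(1) by (intro cycle_of_successively) (auto simp: zs_def)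
  moreover have "length (zip (x # zs) zs) \<ge> 3"
    using \<open>as \<noteq> []\<close> by (cases as) (auto simp: zs_def)
  ultimately show False using assms unfolding undirected_tree_def by blast
qed

text \<open>Library connectedness refers to the symmetric closure of the induced arcs. The closure
  adds nothing to symmetric arcs, and \<open>rtrancl_on S\<close> already confines walks to
  \<open>S\<close>.\<close>

lemma connected_induce_conv:
  assumes "sym (parcs T)"
  shows "connected (with_proj T \<restriction> S) \<longleftrightarrow>
    S \<noteq> {} \<and> (\<forall>u\<in>S. \<forall>v\<in>S. (u, v) \<in> rtrancl_on S (parcs T))"
proof -
  define E where "E = (arcs_ends (with_proj T \<restriction> S))\<^sup>s"
  have E: "E = {(a, b) \<in> parcs T. a \<in> S \<and> b \<in> S}"
    using assms by (auto simp: E_def symcl_def arcs_ends_def arc_to_ends_def sym_def image_iff)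
  have "(u, v) \<in> rtrancl_on S E" if "(u, v) \<in> rtrancl_on S (parcs T)" for u v
    using that
  proof induction
    case (step b c)
    then show ?case
      by (auto simp: E intro: converse_rtrancl_on_into_rtrancl_on)
  qed auto
  moreover have "(u, v) \<in> rtrancl_on S (parcs T)" if "(u, v) \<in> rtrancl_on S E" for u v
    using that by (rule rtrancl_on_mono[rotated 2]) (auto simp: E)
  ultimately show ?thesis unfolding connected_conv E_def[symmetric] by auto
qed


section \<open>A lower bound on the treewidth\<close>

text \<open>Sending the leaf \<open>l\<close> to its neighbour \<open>m\<close> maps walks to walks that avoid \<open>l\<close>.\<close>

lemma rtrancl_on_delete_leaf:
  assumes "(a, b) \<in> rtrancl_on S E" and "sym E"
    and leaf: "\<And>y. y \<in> S \<Longrightarrow> (l, y) \<in> E \<Longrightarrow> y = m"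
    and "a \<noteq> l" "b \<noteq> l" "m \<noteq> l"
  shows "(a, b) \<in> rtrancl_on (S - {l}) E"
proof -
  define f where "f = (\<lambda>t. if t = l then m else t)"
  have "(a, f b) \<in> rtrancl_on (S - {l}) E"
    using assms(1)
  proof (induction rule: rtrancl_on_induct)
    case base
    then show ?case using \<open>a \<noteq> l\<close> by (auto simp: f_def)
  next
    case (step y z)
    \<comment> \<open>A step out of \<open>l\<close> ends in \<open>m\<close> and a step into
      \<open>l\<close> starts in \<open>m\<close>; either way \<open>f y = f z\<close> and the image
      walk stays put. Only the third case adds a step.\<close>
    consider "y = l" | "z = l" "y \<noteq> l" | "y \<noteq> l" "z \<noteq> l" by blast
    then show ?case
    proof cases
      case 1
      then show ?thesis using step leaf[of z] \<open>m \<noteq> l\<close> by (auto simp: f_def)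
    next
      case 2
      then have "(l, y) \<in> E" using step(2) \<open>sym E\<close> by (auto dest: symD)
      then have "y = m" using leaf step by blast
      then show ?thesis using step 2 by (auto simp: f_def)
    next
      case 3
      then show ?thesis using step by (auto simp: f_def intro: rtrancl_on_into_rtrancl_on)
    qed
  qed
  then show ?thesis using \<open>b \<noteq> l\<close> by (simp add: f_def)
qed

text \<open>A leaf whose bag is contained in the bag of its neighbour can be deleted; any other leaf is
  the only node whose bag contains some vertex \<open>v\<close>.\<close>

lemma leafy_bag_contains_neighbourhood:
  fixes B :: "'b \<Rightarrow> 'a set"
  assumes "finite V" "sym E" "irrefl E" "leafy V E"
    and "(\<Union>t\<in>V. B t) \<noteq> {}"
    and "\<And>u v. (u, v) \<in> F \<Longrightarrow> \<exists>t\<in>V. u \<in> B t \<and> v \<in> B t"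
    and "\<And>v s t. s \<in> V \<Longrightarrow> t \<in> V \<Longrightarrow> v \<in> B s \<Longrightarrow> v \<in> B t \<Longrightarrow>
      (s, t) \<in> rtrancl_on {t \<in> V. v \<in> B t} E"
  shows "\<exists>t\<in>V. \<exists>v\<in>B t. {u. (v, u) \<in> F} \<subseteq> B t"
  using assms(1,4-)
proof (induction "card V" arbitrary: V)
  case 0
  then show ?case by auto
next
  case (Suc k)
  have "V \<noteq> {}" using Suc.hyps(2) by auto
  then obtain l where l: "l \<in> V"
    and leaf: "\<And>y z. y \<in> V \<Longrightarrow> z \<in> V \<Longrightarrow> (l, y) \<in> E \<Longrightarrow> (l, z) \<in> E \<Longrightarrow> y = z"
    using Suc.prems(2) unfolding leafy_def by (metis order_refl)
  show ?case
  \<comment> \<open>The disjunct \<open>B l = {}\<close> covers an isolated node with an empty bag,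
    which offers no vertex to choose.\<close>
  proof (cases "B l = {} \<or> (\<exists>m\<in>V. (l, m) \<in> E \<and> B l \<subseteq> B m)")
    case True
    have uni: "(\<Union>t\<in>V - {l}. B t) = (\<Union>t\<in>V. B t)"
    proof (cases "B l = {}")
      case False
      then obtain m where "m \<in> V" "(l, m) \<in> E" "B l \<subseteq> B m" using True by blast
      moreover have "m \<noteq> l" using \<open>(l, m) \<in> E\<close> \<open>irrefl E\<close> by (auto simp: irrefl_def)
      ultimately show ?thesis by blast
    qed auto
    have "\<exists>t\<in>V - {l}. \<exists>v\<in>B t. {u. (v, u) \<in> F} \<subseteq> B t"
    proof (rule Suc.hyps(1))
      show "k = card (V - {l})" using Suc.hyps(2) l Suc.prems(1) by simp
      show "finite (V - {l})" using Suc.prems(1) by simp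
      show "leafy (V - {l}) E" using Suc.prems(2) unfolding leafy_def by blast
      show "(\<Union>t\<in>V - {l}. B t) \<noteq> {}" using uni Suc.prems(3) by simp
    next
      fix u v assume "(u, v) \<in> F"
      then obtain t where t: "t \<in> V" "u \<in> B t" "v \<in> B t" using Suc.prems(4) by blast
      show "\<exists>t\<in>V - {l}. u \<in> B t \<and> v \<in> B t"
      proof (cases "t = l")
        case tl: True
        then obtain m where m: "m \<in> V" "(l, m) \<in> E" "B l \<subseteq> B m" using True t by blast
        moreover have "m \<noteq> l" using m(2) \<open>irrefl E\<close> by (auto simp: irrefl_def)
        ultimately show ?thesis using t tl by blast
      qed (use t in blast)
    next
      fix v s t
      assume st: "s \<in> V - {l}" "t \<in> V - {l}" "v \<in> B s" "v \<in> B t"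
      then have walk: "(s, t) \<in> rtrancl_on {t \<in> V. v \<in> B t} E" using Suc.prems(5) by blast
      have eq: "{t \<in> V - {l}. v \<in> B t} = {t \<in> V. v \<in> B t} - {l}" by blast
      show "(s, t) \<in> rtrancl_on {t \<in> V - {l}. v \<in> B t} E"
      proof (cases "v \<in> B l")
        case False
        then have "{t \<in> V - {l}. v \<in> B t} = {t \<in> V. v \<in> B t}" by blast
        then show ?thesis using walk by simp
      next
        \<comment> \<open>Since \<open>B l\<close> is nonempty, the case assumption supplies a
          neighbour \<open>m\<close>, at which walks through \<open>l\<close> can wait
          instead.\<close>
        case vl: True
        then obtain m where m: "m \<in> V" "(l, m) \<in> E" using True by blast
        have "m \<noteq> l" using m(2) \<open>irrefl E\<close> by (auto simp: irrefl_def)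
        then show ?thesis
          unfolding eq using rtrancl_on_delete_leaf[OF walk \<open>sym E\<close>, of l m] leaf m st by blast
      qed
    qed
    then show ?thesis by blast
  next
    case False
    have "\<exists>v\<in>B l. \<forall>m\<in>V. (l, m) \<in> E \<longrightarrow> v \<notin> B m"
    proof (cases "\<exists>m\<in>V. (l, m) \<in> E")
      case True
      then obtain m where "m \<in> V" "(l, m) \<in> E" by blast
      then show ?thesis using False leaf by blast
    qed (use False in blast)
    then obtain v where v: "v \<in> B l" "\<And>m. m \<in> V \<Longrightarrow> (l, m) \<in> E \<Longrightarrow> v \<notin> B m" by blast
    \<comment> \<open>A walk from \<open>l\<close> through nodes whose bags contain \<open>v\<close>
      cannot take its first step, because no neighbour of \<open>l\<close> has \<open>v\<close> in
      its bag.\<close>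
    have only: "t = l" if "t \<in> V" "v \<in> B t" for t
    proof -
      have "(l, t) \<in> rtrancl_on {t \<in> V. v \<in> B t} E" using Suc.prems(5) l that v(1) by blast
      then show ?thesis
        by (cases rule: converse_rtrancl_on_cases) (use v(2) in \<open>auto dest: in_rtrancl_on_in_F\<close>)
    qed
    have "{u. (v, u) \<in> F} \<subseteq> B l" using Suc.prems(4) only by blast
    then show ?thesis using l v(1) by blast
  qed
qed

text \<open>Some bag holds a vertex and its at least \<open>n\<close> neighbours, hence
  \<open>n + 1\<close> elements; the \<open>- 1\<close> in the width removes the extra one.\<close>

lemma decomposition_width_ge_min_degree:
  assumes G: "simple_graph G" and td: "tree_decomposition G T B"
    and deg: "\<And>v. v \<in> pverts G \<Longrightarrow> n \<le> card {u. (v, u) \<in> parcs G}"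
  shows "n \<le> decomposition_width T B"
proof -
  have tree: "undirected_tree T" and cov: "(\<Union>t\<in>pverts T. B t) = pverts G"
    and arcs: "\<And>u v. (u, v) \<in> parcs G \<Longrightarrow> \<exists>t\<in>pverts T. u \<in> B t \<and> v \<in> B t"
    and con: "\<And>v. v \<in> pverts G \<Longrightarrow> connected (with_proj T \<restriction> {t \<in> pverts T. v \<in> B t})"
    using td unfolding tree_decomposition_def by auto
  have "pair_graph G" using G by (simp add: simple_graph_def)
  then interpret G: pair_graph G .
  have "pair_graph T" using tree by (simp add: undirected_tree_def)
  then interpret T: pair_graph T .
  have symT: "sym (parcs T)" using T.arcs_symmetric by (auto intro: symI)
  have "\<exists>t\<in>pverts T. \<exists>v\<in>B t. {u. (v, u) \<in> parcs G} \<subseteq> B t"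
  proof (rule leafy_bag_contains_neighbourhood[OF T.pair_finite_verts symT])
    show "irrefl (parcs T)" using T.no_loops' by (auto simp: irrefl_def)
    show "leafy (pverts T) (parcs T)" using tree by (rule undirected_tree_leafy)
    show "(\<Union>t\<in>pverts T. B t) \<noteq> {}" using cov G by (simp add: simple_graph_def)
  next
    fix v s t assume "s \<in> pverts T" "t \<in> pverts T" "v \<in> B s" "v \<in> B t"
    moreover from this have "v \<in> pverts G" using cov by blast
    ultimately show "(s, t) \<in> rtrancl_on {t \<in> pverts T. v \<in> B t} (parcs T)"
      using con connected_induce_conv[OF symT] by blast
  qed (rule arcs)
  then obtain t v where t: "t \<in> pverts T" and v: "v \<in> B t" "{u. (v, u) \<in> parcs G} \<subseteq> B t" by blast
  have "v \<in> pverts G" using t v cov by blast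
  have fin: "finite (B t)"
    using t cov G.pair_finite_verts by (metis UN_upper finite_subset)
  have "v \<notin> {u. (v, u) \<in> parcs G}" using G.no_loops' by blast
  moreover have "finite {u. (v, u) \<in> parcs G}" using fin v(2) finite_subset by blast
  ultimately have "Suc n \<le> card (insert v {u. (v, u) \<in> parcs G})"
    using deg[OF \<open>v \<in> pverts G\<close>] by simp
  also have "\<dots> \<le> card (B t)" using v fin by (intro card_mono) auto
  also have "\<dots> \<le> Max ((\<lambda>t. card (B t)) ` pverts T)"
    using t T.pair_finite_verts by (intro Max_ge) auto
  finally show ?thesis unfolding decomposition_width_def by simp
qed


section \<open>Star decompositions\<close>

text \<open>Stars serve as decomposition trees: a single node for an arbitrary graph, and the vertex
  set itself for an arcless graph.\<close>

definition star :: "'a set \<Rightarrow> 'a \<Rightarrow> 'a pair_pre_digraph" where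
  "star V c = \<lparr>pverts = V, parcs = {(c, v) | v. v \<in> V - {c}} \<union> {(v, c) | v. v \<in> V - {c}}\<rparr>"

lemma star_simps [simp]:
  "pverts (star V c) = V"
  "(u, v) \<in> parcs (star V c) \<longleftrightarrow> (u = c \<and> v \<in> V - {c}) \<or> (v = c \<and> u \<in> V - {c})"
  by (auto simp: star_def)

lemma pair_graph_star:
  assumes "finite V" "c \<in> V"
  shows "pair_graph (star V c)"
proof unfold_locales
  have "parcs (star V c) \<subseteq> V \<times> V" using assms(2) by auto
  then show "finite (parcs (star V c))" using assms(1) finite_subset by blast
qed (use assms in \<open>auto simp: symmetric_def sym_def\<close>)

text \<open>Every second vertex of a walk in a star is the centre.\<close>

lemma undirected_tree_star:
  assumes "finite V" "c \<in> V"
  shows "undirected_tree (star V c)"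
  unfolding undirected_tree_def
proof (intro conjI notI)
  show "pair_graph (star V c)" using assms by (rule pair_graph_star)
  have E: "(parcs (star V c))\<^sup>s = parcs (star V c)" by (auto simp: symcl_def image_iff)
  have "(u, v) \<in> rtrancl_on V (parcs (star V c))" if "u \<in> V" "v \<in> V" for u v
  proof -
    have "(u, c) \<in> rtrancl_on V (parcs (star V c))"
    proof (cases "u = c")
      case False
      then show ?thesis
        using that assms by (rule_tac rtrancl_on_into_rtrancl_on[OF rtrancl_on_refl]) auto
    qed (use assms in simp)
    then show ?thesis
    proof (cases "v = c")
      case False
      then show ?thesis
        using that \<open>(u, c) \<in> _\<close> by (rule_tac rtrancl_on_into_rtrancl_on) auto
    qed simp
  qed
  then show "connected (with_proj (star V c))" using assms by (auto simp: connected_conv E)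
next
  assume "\<exists>p. pre_digraph.cycle (with_proj (star V c)) p \<and> 3 \<le> length p"
  then obtain p u where p: "3 \<le> length p" "set p \<subseteq> parcs (star V c)" "pcas u p u"
    "distinct (tl (pawalk_verts u p))"
    by (auto simp: pre_digraph.cycle_def pre_digraph.awalk_def cas_with_proj_eq
        awalk_verts_with_proj_eq)
  obtain e1 e2 e3 q where q: "p = e1 # e2 # e3 # q"
    using p(1) by (auto simp: numeral_3_eq_3 Suc_le_length_iff)
  have ends: "v \<in> set (pawalk_verts v r)" "w \<in> set (pawalk_verts v r)" if "pcas v r w" for v r w
    using that by (induction v r w rule: pcas.induct) auto
  have "pcas (snd e3) q u" using p(3) q by simp
  \<comment> \<open>If \<open>u = c\<close>, then \<open>snd e2\<close> and the final
    \<open>u\<close> are both \<open>c\<close>; otherwise \<open>snd e1\<close> and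
    \<open>snd e3\<close> are. Both repetitions lie in the tail of the vertex list.\<close>
  from ends[OF this] show False using p q by (cases e1; cases e2; cases e3) auto
qed

text \<open>Ensures that the \<open>LEAST\<close> in \<open>treewidth\<close> ranges over a nonempty
  set and is attained.\<close>

lemma tree_decomposition_single_bag:
  fixes c :: 'b
  assumes "pair_graph G"
  shows "tree_decomposition G (star {c} c) (\<lambda>_. pverts G)"
proof -
  interpret pair_graph G by fact
  have "sym (parcs (star {c} c))" by (auto simp: sym_def)
  then show ?thesis
    using wellformed' unfolding tree_decomposition_def
    by (auto simp: undirected_tree_star connected_induce_conv)
qed

lemma treewidth_ge_min_degree:
  assumes "simple_graph G"
    and "\<And>v. v \<in> pverts G \<Longrightarrow> n \<le> card {u. (v, u) \<in> parcs G}"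
  shows "n \<le> treewidth G"
proof -
  have "pair_graph G" using assms(1) by (simp add: simple_graph_def)
  then have "\<exists>k. \<exists>(T :: nat pair_pre_digraph) B.
      tree_decomposition G T B \<and> decomposition_width T B = k"
    by (intro exI conjI, rule tree_decomposition_single_bag) (rule refl)
  then have "\<exists>(T :: nat pair_pre_digraph) B.
      tree_decomposition G T B \<and> decomposition_width T B = treewidth G"
    unfolding treewidth_def by (rule LeastI_ex)
  then obtain T :: "nat pair_pre_digraph" and B
    where "tree_decomposition G T B" "decomposition_width T B = treewidth G" by blast
  then show ?thesis using decomposition_width_ge_min_degree[OF assms(1) _ assms(2)] by metis
qed

lemma treewidth_arcless:
  fixes G :: "nat pair_pre_digraph"
  assumes "simple_graph G" "parcs G = {}"
  shows "treewidth G = 0"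
proof -
  obtain c where c: "c \<in> pverts G" using assms(1) by (auto simp: simple_graph_def)
  interpret pair_graph G using assms(1) by (simp add: simple_graph_def)
  \<comment> \<open>With no arcs to cover, singleton bags on any tree over the vertices suffice. The
    vertices are natural numbers, as \<open>treewidth\<close> demands of tree nodes.\<close>
  define T where "T = star (pverts G) c"
  have T: "undirected_tree T" "pverts T = pverts G"
    using undirected_tree_star[OF pair_finite_verts c] by (simp_all add: T_def)
  have "sym (parcs T)" by (auto simp: T_def sym_def)
  then have "connected (with_proj T \<restriction> {v})" for v by (simp add: connected_induce_conv)
  moreover have "{t \<in> pverts T. v \<in> {t}} = {v}" if "v \<in> pverts G" for v
    using that T(2) by auto
  ultimately have "tree_decomposition G T (\<lambda>t. {t})"
    using T assms(2) unfolding tree_decomposition_def by simp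
  moreover have "(\<lambda>t. card {t}) ` pverts T = {1}" using c T(2) by auto
  then have "decomposition_width T (\<lambda>t. {t}) = 0" by (simp add: decomposition_width_def)
  ultimately have "\<exists>(T :: nat pair_pre_digraph) B.
      tree_decomposition G T B \<and> decomposition_width T B = 0" by blast
  then show ?thesis unfolding treewidth_def by (rule Least_eq_0)
qed


section \<open>Word graphs\<close>

lemma word_graph_simps [simp]:
  "pverts (word_graph L w) = set w"
  "(u, v) \<in> parcs (word_graph L w) \<longleftrightarrow>
     u \<in> set w \<and> v \<in> set w \<and> u \<noteq> v \<and> pair_morphism u v w \<in> L"
  by (auto simp: word_graph_def)

lemma edgeless_simps [simp]:
  "pverts (edgeless n) = {1..n}" "parcs (edgeless n) = {}"
  by (simp_all add: edgeless_def)

lemma exchange01_pair_morphism: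
  assumes "u \<noteq> v"
  shows "exchange01 (pair_morphism u v w) = pair_morphism v u w"
  using assms by (induction w) (auto simp: exchange01_def pair_morphism_def)

lemma symmetric01_exchange:
  assumes "symmetric01 L" "x \<in> L"
  shows "exchange01 x \<in> L"
  using assms unfolding symmetric01_def by blast

text \<open>Swapping \<open>u\<close> and \<open>v\<close> exchanges the letters of the projection,
  so the symmetry of \<open>L\<close> makes the arc relation symmetric.\<close>

lemma pair_graph_word_graph:
  assumes "symmetric01 L"
  shows "pair_graph (word_graph L w)"
proof unfold_locales
  have "parcs (word_graph L w) \<subseteq> set w \<times> set w" by auto
  then show "finite (parcs (word_graph L w))" using finite_subset by blast
  show "symmetric (word_graph L w)"
    using symmetric01_exchange[OF assms] exchange01_pair_morphism
    by (fastforce simp: symmetric_def sym_def)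
qed auto

lemma graph_iso_refl:
  fixes G :: "'a pair_pre_digraph"
  assumes "pair_graph G"
  shows "graph_iso G G"
proof -
  interpret pair_graph G by fact
  define f :: "('a, 'a \<times> 'a, 'a, 'a \<times> 'a) digraph_isomorphism"
    where "f = \<lparr>iso_verts = id, iso_arcs = id, iso_head = snd, iso_tail = fst\<rparr>"
  have "digraph_isomorphism f" using wf_digraph by (simp add: digraph_isomorphism_def f_def)
  moreover have "with_proj G = app_iso f (with_proj G)" by (simp add: app_iso_def f_def with_proj_def)
  ultimately show ?thesis unfolding graph_iso_def digraph_iso_def by blast
qed

lemma graph_iso_arcless:
  assumes "graph_iso G H" "parcs H = {}"
  shows "parcs G = {}"
  using assms unfolding graph_iso_def digraph_iso_def app_iso_def with_proj_def by auto

lemma graph_iso_edgeless_card: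
  fixes G :: "'a pair_pre_digraph"
  assumes "finite (pverts G)" "parcs G = {}"
  shows "graph_iso G (edgeless (card (pverts G)))"
proof -
  obtain h where h: "bij_betw h (pverts G) {1..card (pverts G)}"
    using finite_same_card_bij[OF assms(1), of "{1..card (pverts G)}"] by auto
  \<comment> \<open>\<open>iso_arcs\<close> may be arbitrary, as there is no arc to map.\<close>
  define f :: "('a, 'a \<times> 'a, nat, nat \<times> nat) digraph_isomorphism"
    where "f = \<lparr>iso_verts = h, iso_arcs = (\<lambda>_. undefined), iso_head = snd, iso_tail = fst\<rparr>"
  have "wf_digraph (with_proj G)" using assms(2) by unfold_locales auto
  then have "pre_digraph.digraph_isomorphism (with_proj G) f"
    using h assms(2) by (simp add: pre_digraph.digraph_isomorphism_def f_def bij_betw_def)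
  moreover have "with_proj (edgeless (card (pverts G))) = app_iso f (with_proj G)"
    using h assms(2) by (simp add: app_iso_def f_def with_proj_def bij_betw_def)
  ultimately show ?thesis unfolding graph_iso_def digraph_iso_def by blast
qed

lemma set_pair_morphism:
  assumes "u \<in> set w" "v \<in> set w" "u \<noteq> v"
  shows "0 \<in> set (pair_morphism u v w)" "1 \<in> set (pair_morphism u v w)"
  using assms by (force simp: pair_morphism_def)+

text \<open>A projection to two occurring letters contains both 0 and 1, so it is never
  unary.\<close>

lemma word_graph_arcless:
  assumes "L \<subseteq> lists {0} \<union> lists {1}"
  shows "parcs (word_graph L w) = {}"
proof -
  have "pair_morphism u v w \<notin> L" if "u \<in> set w" "v \<in> set w" "u \<noteq> v" for u v
    using set_pair_morphism[OF that] assms by (auto simp: lists_eq_set)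
  then show ?thesis by (auto simp: word_graph_def)
qed

lemma graph_class_eq_edgeless:
  assumes "L \<subseteq> lists {0} \<union> lists {1}"
  shows "graph_class L = iso_closure {edgeless n | n. n \<ge> 1}"
proof (intro equalityI subsetI)
  fix G assume "G \<in> graph_class L"
  then obtain w :: "nat list" where G: "simple_graph G" and iso: "graph_iso G (word_graph L w)"
    by (auto simp: graph_class_def representable_def)
  then interpret pair_graph G by (simp add: simple_graph_def)
  have "parcs G = {}" using iso word_graph_arcless[OF assms] by (rule graph_iso_arcless)
  then have "graph_iso G (edgeless (card (pverts G)))"
    using pair_finite_verts by (rule graph_iso_edgeless_card[rotated])
  moreover have "card (pverts G) \<ge> 1"
    using G pair_finite_verts by (simp add: simple_graph_def Suc_le_eq card_gt_0_iff)
  ultimately show "G \<in> iso_closure {edgeless n | n. n \<ge> 1}"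
    using G by (auto simp: iso_closure_def)
next
  fix G assume "G \<in> iso_closure {edgeless n | n. n \<ge> 1}"
  then obtain n where G: "simple_graph G" and n: "n \<ge> 1" and iso: "graph_iso G (edgeless n)"
    by (auto simp: iso_closure_def)
  \<comment> \<open>Any word with letter set \<open>{1..n}\<close> would do, since all these word
    graphs are arcless.\<close>
  have "word_graph L [1..<Suc n] = edgeless n"
    using word_graph_arcless[OF assms, of "[1..<Suc n]"]
    by (intro pair_pre_digraph.equality) auto
  then show "G \<in> graph_class L"
    using G iso n unfolding graph_class_def representable_def
    by (auto intro!: exI[of _ "[1..<Suc n]"])
qed

lemma treewidth_iso_edgeless:
  assumes "G \<in> iso_closure {edgeless n | n. n \<ge> 1}"
  shows "treewidth G = 0"
  using assms by (auto simp: iso_closure_def intro!: treewidth_arcless dest: graph_iso_arcless)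


section \<open>Complete bipartite graphs\<close>

definition blow_up :: "nat \<Rightarrow> bit list \<Rightarrow> nat list" where
  "blow_up n x = concat (map (\<lambda>b. if b = 0 then [0..<n] else [n..<2 * n]) x)"

lemma pair_morphism_simps [simp]:
  "pair_morphism u v [] = []"
  "pair_morphism u v (x # xs) =
     (if x = u then [0] else if x = v then [1] else []) @ pair_morphism u v xs"
  "pair_morphism u v (xs @ ys) = pair_morphism u v xs @ pair_morphism u v ys"
  by (simp_all add: pair_morphism_def)

lemma pair_morphism_eq_Nil:
  "u \<notin> set xs \<Longrightarrow> v \<notin> set xs \<Longrightarrow> pair_morphism u v xs = []"
  by (induction xs) auto

lemma pair_morphism_distinct:
  assumes "distinct xs"
  shows "u \<in> set xs \<Longrightarrow> v \<notin> set xs \<Longrightarrow> pair_morphism u v xs = [0]"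
    and "u \<notin> set xs \<Longrightarrow> v \<in> set xs \<Longrightarrow> pair_morphism u v xs = [1]"
  using assms by (auto dest!: split_list simp: pair_morphism_eq_Nil)

text \<open>Each block contains exactly one of \<open>u\<close> and \<open>v\<close>, exactly once,
  and thus projects to the letter it replaced.\<close>

lemma pair_morphism_blow_up:
  assumes "u < n" "n \<le> v" "v < 2 * n"
  shows "pair_morphism u v (blow_up n x) = x"
proof (induction x)
  case Nil
  then show ?case by (simp add: blow_up_def)
next
  case (Cons b x)
  have "blow_up n (b # x) = (if b = 0 then [0..<n] else [n..<2 * n]) @ blow_up n x"
    by (simp add: blow_up_def)
  then show ?case
    using Cons assms by (cases b) (auto simp: pair_morphism_distinct)
qed

text \<open>Arcs inside a side depend on \<open>L\<close> but can only raise degrees; the opposite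
  side alone gives every vertex \<open>n\<close> neighbours.\<close>

lemma treewidth_blow_up:
  assumes L: "symmetric01 L" "x \<in> L" and x: "0 \<in> set x" "1 \<in> set x" and "n > 0"
  shows "word_graph L (blow_up n x) \<in> graph_class L"
    and "n \<le> treewidth (word_graph L (blow_up n x))"
proof -
  let ?G = "word_graph L (blow_up n x)"
  have "b = 0 \<or> b = 1" for b :: bit by (cases b) simp_all
  then have "set x = {0, 1}" using x by blast
  then have "set (blow_up n x) = {0..<n} \<union> {n..<2 * n}"
    by (simp add: blow_up_def Un_commute)
  also have "\<dots> = {..<2 * n}" by auto
  finally have set: "set (blow_up n x) = {..<2 * n}" .
  have G: "pair_graph ?G" using L(1) by (rule pair_graph_word_graph)
  then interpret pair_graph ?G .
  have "0 \<in> set (blow_up n x)" using \<open>n > 0\<close> unfolding set by simp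
  then have ne: "blow_up n x \<noteq> []" by auto
  then have simple: "simple_graph ?G" using G by (simp add: simple_graph_def)
  then have "representable L ?G"
    unfolding representable_def using ne graph_iso_refl[OF G] by blast
  then show "?G \<in> graph_class L" by (simp add: graph_class_def)
  have arc: "(u, v) \<in> parcs ?G" if "u < n" "n \<le> v" "v < 2 * n" for u v
    using pair_morphism_blow_up[OF that, of x] that L(2) set by auto
  show "n \<le> treewidth ?G"
    using simple
  proof (rule treewidth_ge_min_degree)
    fix v assume "v \<in> pverts ?G"
    then have "v < 2 * n" using set by simp
    have "{u. (v, u) \<in> parcs ?G} \<subseteq> set (blow_up n x)" by auto
    then have fin: "finite {u. (v, u) \<in> parcs ?G}" by (rule finite_subset) simp
    show "n \<le> card {u. (v, u) \<in> parcs ?G}"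
    proof (cases "v < n")
      case True
      then have "{n..<2 * n} \<subseteq> {u. (v, u) \<in> parcs ?G}"
        using arc by (simp add: subset_iff del: word_graph_simps)
      from card_mono[OF fin this] show ?thesis by simp
    next
      case False
      then have "{0..<n} \<subseteq> {u. (v, u) \<in> parcs ?G}"
        using arcs_symmetric[OF arc] \<open>v < 2 * n\<close> by (simp add: subset_iff del: word_graph_simps)
      from card_mono[OF fin this] show ?thesis by simp
    qed
  qed
qed

lemma bounded_treewidth_imp_unary:
  assumes "symmetric01 L" "\<forall>G\<in>graph_class L. treewidth G \<le> t"
  shows "L \<subseteq> lists {0} \<union> lists {1}"
proof (rule ccontr)
  assume "\<not> L \<subseteq> lists {0} \<union> lists {1}"
  then obtain x where "x \<in> L" and x: "x \<notin> lists {0}" "x \<notin> lists {1}" by blast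
  obtain a where "a \<in> set x" "a \<noteq> 0" using x(1) unfolding lists_eq_set by blast
  moreover obtain b where "b \<in> set x" "b \<noteq> 1" using x(2) unfolding lists_eq_set by blast
  ultimately have "0 \<in> set x" "1 \<in> set x" by simp_all
  \<comment> \<open>Blocks of length \<open>Suc t\<close> exceed the assumed bound
    \<open>t\<close>.\<close>
  note G = treewidth_blow_up[OF assms(1) \<open>x \<in> L\<close> this zero_less_Suc[of t]]
  have "Suc t \<le> t" using G(2) bspec[OF assms(2) G(1)] by (rule le_trans)
  then show False by simp
qed

theorem mainTheorem5:
  fixes L :: "bit list set"
  assumes "symmetric01 L"
  shows "((\<exists>t::nat. \<forall>G\<in>graph_class L. treewidth G \<le> t)
            \<longleftrightarrow> (\<forall>G\<in>graph_class L. treewidth G = 0))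
       \<and> ((\<forall>G\<in>graph_class L. treewidth G = 0)
            \<longleftrightarrow> graph_class L = iso_closure {edgeless n | n. n \<ge> 1})
       \<and> (graph_class L = iso_closure {edgeless n | n. n \<ge> 1}
            \<longleftrightarrow> L \<subseteq> lists {0} \<union> lists {1})"
proof -
  have "L \<subseteq> lists {0} \<union> lists {1}" if "\<exists>t::nat. \<forall>G\<in>graph_class L. treewidth G \<le> t"
    using bounded_treewidth_imp_unary[OF assms] that by blast
  moreover have "\<forall>G\<in>graph_class L. treewidth G = 0"
    if "graph_class L = iso_closure {edgeless n | n. n \<ge> 1}"
    using that treewidth_iso_edgeless by blast
  moreover have "\<exists>t::nat. \<forall>G\<in>graph_class L. treewidth G \<le> t"
    if "\<forall>G\<in>graph_class L. treewidth G = 0"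
    using that by auto
  \<comment> \<open>The added lemma leads from unary \<open>L\<close> to the edgeless class and so
    closes the cycle of implications.\<close>
  ultimately show ?thesis using graph_class_eq_edgeless[of L] by blast
qed

end
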